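(* Let $n\in\mathbb{Z}^+$ with $n\ge 2$ and let $\widehat{\mathcal T}=(\mathbb{Z}^+)^\infty$ be the set of all infinite sequences of positive integers. For every ${\bf k}=(k_1,k_2,\dots)\in\widehat{\mathcal T}$ the limit $$\mathfrak{h}_n({\bf k})=\lim_{r\to+\infty}H_n^\star(k_1,\dots,k_r)$$ exists, and the map ${\bf k}\mapsto \mathfrak{h}_n({\bf k})$ is a bijection $$\mathfrak{h}_n:\widehat{\mathcal T}\to(1,n].$$
   Context: $\mathbb{Z}^+=\{1,2,3,\dots\}$. For $n\in\mathbb{Z}^+$, $r\ge 1$ and $(k_1,\dots,k_r)\in(\mathbb{Z}^+)^r$, $$H_n^\star(k_1,\dots,k_r)=\sum_{n\ge m_1\ge\cdots\ge m_r\ge 1}\frac{1}{m_1^{k_1}\cdots m_r^{k_r}},$$ the sum being over integers $m_1,\dots,m_r$. *)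

theory Defs
  imports "HOL-Analysis.Analysis"
begin

text \<open>A tuple $(m_1, \dots, m_r)$ is a list of length $r$; its entry $m_{i+1}$ is \<open>ms ! i\<close>.\<close>

definition star_chains :: "nat \<Rightarrow> nat \<Rightarrow> nat list set" where
  "star_chains n r = {ms. length ms = r \<and> sorted_wrt (\<ge>) ms \<and> set ms \<subseteq> {1..n}}"

lemma finite_star_chains: "finite (star_chains n r)"
  by (rule finite_subset[OF _ finite_lists_length_eq[of "{1..n}" r]])
     (auto simp: star_chains_def)

definition H_star :: "nat \<Rightarrow> nat list \<Rightarrow> real" where
  "H_star n ks =
     (\<Sum>ms\<in>star_chains n (length ks). 1 / (\<Prod>i<length ks. real (ms ! i) ^ (ks ! i)))"

text \<open>Infinite sequences are indexed from 0, so $k_{i+1}$ is \<open>k i\<close> and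
  $(k_1, \dots, k_r)$ is \<open>map k [0..<r]\<close>.\<close>

definition T_hat :: "(nat \<Rightarrow> nat) set" where
  "T_hat = {k. \<forall>i. k i \<ge> 1}"

text \<open>The value is unspecified when the limit does not exist.\<close>

definition h_lim :: "nat \<Rightarrow> (nat \<Rightarrow> nat) \<Rightarrow> real" where
  "h_lim n k = lim (\<lambda>r. H_star n (map k [0..<r]))"

end

theory Submission
  imports Defs
begin

text \<open>
  Summing over the largest index first turns the nested sum into an iteration: with
  $(S_k f)(n) = \sum_{m=1}^{n} f(m)/m^k$ one has
  $H_n^\star(k_1,\dots,k_r) = (S_{k_1} \cdots S_{k_r} 1)(n)$.  Attach to a prefix
  $p = (k_1,\dots,k_r)$ the half-open interval $(L_p, U_p]$ with
  $L_p = (S_{k_1} \cdots S_{k_r} 1)(n)$ and $U_p = (S_{k_1} \cdots S_{k_r} \mathrm{id})(n)$;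
  the empty prefix has the interval $(1,n]$.

  Everything rests on the identity $S_{a+1}\,\mathrm{id} = S_a 1$, which says that
  $U_{p,a+1} = L_{p,a}$: the interval of $(p,a+1)$ ends exactly where that of $(p,a)$ begins.
  Moreover $S_1 \mathrm{id} = \mathrm{id}$, so $U_{p,1} = U_p$, and $S_a 1 \to 1$ pointwise as
  $a \to \infty$, so $L_{p,a} \to L_p$.  Hence the intervals of $(p,1), (p,2), \dots$ tile
  that of $p$ from right to left without gap or overlap, just as half-open dyadic
  intervals are cut up by non-terminating binary expansions (the case $n = 2$).

  The intervals along a sequence ${\bf k}$ are nested and
  $U_p - L_p = (S_{k_1} \cdots S_{k_r} (\mathrm{id}-1))(n) \le (1-1/n)^r (n-1)$, so they shrink
  to a single point.  The left ends $L_p$ are the truncated sums themselves and increase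
  strictly, so that point is $\mathfrak{h}_n({\bf k})$ and it lies in all the half-open
  intervals.  Sequences that differ at some place have values in disjoint
  intervals, which gives injectivity; conversely, every $x \in (1,n]$ picks out, prefix after
  prefix, the unique tile that contains it, which gives surjectivity.
\<close>


section \<open>Iterated summation\<close>

definition weighted_sum :: "nat \<Rightarrow> (nat \<Rightarrow> real) \<Rightarrow> nat \<Rightarrow> real" where
  "weighted_sum k f n = (\<Sum>m=1..n. f m / real m ^ k)"

definition nested_sum :: "nat list \<Rightarrow> (nat \<Rightarrow> real) \<Rightarrow> nat \<Rightarrow> real" where
  "nested_sum = foldr weighted_sum"

lemma nested_sum_Nil [simp]: "nested_sum [] f = f"
  by (simp add: nested_sum_def)

lemma nested_sum_Cons [simp]: "nested_sum (k # ks) f = weighted_sum k (nested_sum ks f)"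
  by (simp add: nested_sum_def)

lemma nested_sum_snoc: "nested_sum (ks @ [k]) f = nested_sum ks (weighted_sum k f)"
  by (simp add: nested_sum_def)

lemma star_chains_Suc:
  "star_chains n (Suc r) = (\<Union>m\<in>{1..n}. (#) m ` star_chains m r)"
proof (intro subset_antisym subsetI)
  fix ms assume "ms \<in> star_chains n (Suc r)"
  then obtain m ms' where "ms = m # ms'" "m \<in> {1..n}" "ms' \<in> star_chains m r"
    by (cases ms) (auto simp: star_chains_def subset_iff)
  then show "ms \<in> (\<Union>m\<in>{1..n}. (#) m ` star_chains m r)" by blast
next
  fix ms assume "ms \<in> (\<Union>m\<in>{1..n}. (#) m ` star_chains m r)"
  then show "ms \<in> star_chains n (Suc r)"
    by (force simp: star_chains_def)
qed

lemma H_star_eq_nested_sum: "H_star n ks = nested_sum ks (\<lambda>_. 1) n"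
proof (induction ks arbitrary: n)
  case Nil
  have "star_chains n 0 = {[]}" by (auto simp: star_chains_def)
  then show ?case by (simp add: H_star_def)
next
  case (Cons k ks)
  let ?r = "length ks"
  let ?w = "\<lambda>ms. 1 / (\<Prod>i<?r. real (ms ! i) ^ (ks ! i))"
  let ?W = "\<lambda>ms. 1 / (\<Prod>i<Suc ?r. real (ms ! i) ^ ((k # ks) ! i))"
  have "H_star n (k # ks) = (\<Sum>ms\<in>(\<Union>m\<in>{1..n}. (#) m ` star_chains m ?r). ?W ms)"
    by (simp add: H_star_def star_chains_Suc)
  also have "\<dots> = (\<Sum>m=1..n. \<Sum>ms\<in>(#) m ` star_chains m ?r. ?W ms)"
    by (rule sum.UNION_disjoint) (auto simp: finite_star_chains)
  also have "\<dots> = (\<Sum>m=1..n. \<Sum>ms\<in>star_chains m ?r. ?w ms / real m ^ k)"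
    by (rule sum.cong)
       (simp_all add: sum.reindex prod.lessThan_Suc_shift mult.commute del: prod.lessThan_Suc)
  also have "\<dots> = (\<Sum>m=1..n. H_star m ks / real m ^ k)"
    by (simp add: H_star_def sum_divide_distrib)
  finally show ?case by (simp add: weighted_sum_def Cons.IH)
qed

lemma nested_sum_mono:
  assumes "\<And>m. m \<ge> 1 \<Longrightarrow> f m \<le> g m" and "n \<ge> 1"
  shows "nested_sum ks f n \<le> nested_sum ks g n"
  using assms(2)
proof (induction ks arbitrary: n)
  case (Cons k ks)
  then show ?case
    by (auto simp: weighted_sum_def intro!: sum_mono divide_right_mono)
qed (simp add: assms(1))

text \<open>Strictness is asked for from 2 on only, because all functions compared below agree at 1:
  $(S_k f)(1) = f(1)$.  It survives each step because the summand $m = n \ge 2$ is strict.\<close>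

lemma nested_sum_strict_mono:
  assumes le: "\<And>m. m \<ge> 1 \<Longrightarrow> f m \<le> g m" and less: "\<And>m. m \<ge> 2 \<Longrightarrow> f m < g m"
    and "n \<ge> 2"
  shows "nested_sum ks f n < nested_sum ks g n"
  using \<open>n \<ge> 2\<close>
proof (induction ks arbitrary: n)
  case (Cons k ks)
  show ?case unfolding nested_sum_Cons weighted_sum_def
  proof (rule sum_strict_mono_ex1)
    show "\<forall>m\<in>{1..n}. nested_sum ks f m / real m ^ k \<le> nested_sum ks g m / real m ^ k"
      using nested_sum_mono[OF le] by (auto intro!: divide_right_mono)
    show "\<exists>m\<in>{1..n}. nested_sum ks f m / real m ^ k < nested_sum ks g m / real m ^ k"
      using Cons by (intro bexI[of _ n] divide_strict_right_mono) auto
  qed simp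
qed (simp add: less)

lemma nested_sum_diff:
  "nested_sum ks (\<lambda>m. f m - g m) n = nested_sum ks f n - nested_sum ks g n"
  by (induction ks arbitrary: n) (simp_all add: weighted_sum_def diff_divide_distrib sum_subtractf)

lemma tendsto_nested_sum:
  assumes "\<And>m. m \<ge> 1 \<Longrightarrow> (\<lambda>a. f a m) \<longlonglongrightarrow> g m" and "n \<ge> 1"
  shows "(\<lambda>a. nested_sum ks (f a) n) \<longlonglongrightarrow> nested_sum ks g n"
  using assms(2)
proof (induction ks arbitrary: n)
  case (Cons k ks)
  then show ?case
    by (auto simp: weighted_sum_def intro!: tendsto_sum tendsto_divide)
qed (simp add: assms(1))


section \<open>One summation step on the constant and the identity\<close>

lemma weighted_sum_one_ge: "n \<ge> 1 \<Longrightarrow> weighted_sum k (\<lambda>_. 1) n \<ge> 1"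
  unfolding weighted_sum_def
  using member_le_sum[of 1 "{1..n}" "\<lambda>m. 1 / real m ^ k"] by simp

lemma weighted_sum_one_gt:
  assumes "n \<ge> 2" shows "weighted_sum k (\<lambda>_. 1) n > 1"
proof -
  have "weighted_sum k (\<lambda>_. 1) n = weighted_sum k (\<lambda>_. 1) (n - 1) + 1 / real n ^ k"
    using assms by (cases n) (auto simp: weighted_sum_def)
  with weighted_sum_one_ge[of "n - 1" k] assms show ?thesis
    by (smt (verit) divide_pos_pos le_diff_conv2 of_nat_0_less_iff one_add_one zero_less_power
        add_leD2 less_le_trans zero_less_two)
qed

text \<open>The cancellation $m / m^{k+1} = 1 / m^k$ is what makes adjacent intervals share an endpoint.\<close>

lemma weighted_sum_Suc_real: "weighted_sum (Suc k) real = weighted_sum k (\<lambda>_. 1)"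
  by (rule ext) (auto simp: weighted_sum_def intro!: sum.cong)

lemma weighted_sum_1_real: "weighted_sum (Suc 0) real = real"
  by (rule ext) (simp add: weighted_sum_Suc_real, simp add: weighted_sum_def)

lemma weighted_sum_antimono:
  assumes "k \<le> l" and "\<And>m. m \<ge> 1 \<Longrightarrow> f m \<ge> 0"
  shows "weighted_sum l f n \<le> weighted_sum k f n"
  unfolding weighted_sum_def
  using assms by (auto intro!: sum_mono divide_left_mono power_increasing)

lemma weighted_sum_one_tendsto:
  assumes "n \<ge> 1" shows "(\<lambda>k. weighted_sum k (\<lambda>_. 1) n) \<longlonglongrightarrow> 1"
proof -
  have "(\<lambda>k. \<Sum>m=1..n. 1 / real m ^ k) \<longlonglongrightarrow> (\<Sum>m=1..n. if m = 1 then 1 else 0)"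
  proof (intro tendsto_sum)
    fix m assume "m \<in> {1..n}"
    then consider "m = 1" | "m \<ge> 2" by fastforce
    then show "(\<lambda>k. 1 / real m ^ k) \<longlonglongrightarrow> (if m = 1 then 1 else 0)"
    proof cases
      case 2
      then have "(\<lambda>k. (1 / real m) ^ k) \<longlonglongrightarrow> 0" by (intro LIMSEQ_power_zero) simp
      with 2 show ?thesis by (simp add: power_one_over)
    qed simp
  qed
  with assms show ?thesis by (simp add: weighted_sum_def)
qed


section \<open>Intervals attached to prefixes\<close>

abbreviation lower :: "nat \<Rightarrow> nat list \<Rightarrow> real" where
  "lower n ks \<equiv> nested_sum ks (\<lambda>_. 1) n"

abbreviation upper :: "nat \<Rightarrow> nat list \<Rightarrow> real" where
  "upper n ks \<equiv> nested_sum ks real n"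

lemma lower_snoc_gt: "n \<ge> 2 \<Longrightarrow> lower n ks < lower n (ks @ [k])"
  unfolding nested_sum_snoc
  by (intro nested_sum_strict_mono weighted_sum_one_ge weighted_sum_one_gt)

lemma upper_snoc_le: "n \<ge> 1 \<Longrightarrow> k \<ge> 1 \<Longrightarrow> upper n (ks @ [k]) \<le> upper n ks"
  unfolding nested_sum_snoc
  using weighted_sum_antimono[of "Suc 0" k real]
  by (intro nested_sum_mono) (simp_all add: weighted_sum_1_real)

lemma upper_snoc_1: "upper n (ks @ [Suc 0]) = upper n ks"
  by (simp add: nested_sum_snoc weighted_sum_1_real)

lemma upper_snoc_Suc: "upper n (ks @ [Suc k]) = lower n (ks @ [k])"
  by (simp add: nested_sum_snoc weighted_sum_Suc_real)

lemma lower_le_upper: "n \<ge> 1 \<Longrightarrow> lower n ks \<le> upper n ks"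
  by (rule nested_sum_mono) auto

lemma upper_snoc_le_lower_snoc:
  assumes "n \<ge> 1" and "k < l"
  shows "upper n (ks @ [l]) \<le> lower n (ks @ [k])"
proof -
  have "upper n (ks @ [l]) \<le> upper n (ks @ [Suc k])"
    unfolding nested_sum_snoc using assms
    by (intro nested_sum_mono weighted_sum_antimono) auto
  then show ?thesis by (simp add: upper_snoc_Suc)
qed

lemma lower_snoc_tendsto: "n \<ge> 1 \<Longrightarrow> (\<lambda>a. lower n (ks @ [a])) \<longlonglongrightarrow> lower n ks"
  unfolding nested_sum_snoc by (intro tendsto_nested_sum weighted_sum_one_tendsto)

text \<open>For exponent 1, the worst case, each summand of $\sum_{m=2}^{j} (m-1)/m$ is at most
  $1 - 1/n$, and there are $j - 1$ of them.  The right-hand side is again a multiple of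
  $j - 1$, so the bound can be iterated; this makes the lengths of the intervals, which are
  nested sums of $m - 1$, decay geometrically.\<close>

lemma weighted_sum_pred_le:
  assumes "1 \<le> j" and "j \<le> n" and "k \<ge> 1"
  shows "weighted_sum k (\<lambda>m. real m - 1) j \<le> (1 - 1 / real n) * (real j - 1)"
proof -
  have "weighted_sum k (\<lambda>m. real m - 1) j \<le> weighted_sum 1 (\<lambda>m. real m - 1) j"
    using assms by (intro weighted_sum_antimono) auto
  also have "\<dots> \<le> (1 - 1 / real n) * (real j - 1)"
    using assms(1,2)
  proof (induction j rule: nat_induct_at_least)
    case base
    then show ?case by (simp add: weighted_sum_def)
  next
    case (Suc j)
    have "real j / real (Suc j) = 1 - 1 / real (Suc j)" by (simp add: field_simps)
    also have "\<dots> \<le> 1 - 1 / real n"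
      using Suc.prems by (intro diff_left_mono divide_left_mono) auto
    finally have "real j / real (Suc j) \<le> 1 - 1 / real n" .
    moreover have "weighted_sum 1 (\<lambda>m. real m - 1) (Suc j)
        = weighted_sum 1 (\<lambda>m. real m - 1) j + real j / real (Suc j)"
      by (simp add: weighted_sum_def)
    moreover have "weighted_sum 1 (\<lambda>m. real m - 1) j \<le> (1 - 1 / real n) * (real j - 1)"
      using Suc by simp
    ultimately show ?case by (simp add: algebra_simps diff_divide_distrib)
  qed
  finally show ?thesis .
qed

lemma upper_minus_lower_le:
  assumes "1 \<le> j" and "j \<le> n" and "\<forall>k\<in>set ks. k \<ge> 1"
  shows "upper j ks - lower j ks \<le> (1 - 1 / real n) ^ length ks * (real j - 1)"
proof -
  have "nested_sum ks (\<lambda>m. real m - 1) j \<le> (1 - 1 / real n) ^ length ks * (real j - 1)"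
    using assms
  proof (induction ks arbitrary: j)
    case (Cons k ks)
    let ?c = "1 - 1 / real n"
    have c: "?c \<ge> 0" using Cons.prems by simp
    have "nested_sum (k # ks) (\<lambda>m. real m - 1) j
        \<le> weighted_sum k (\<lambda>m. ?c ^ length ks * (real m - 1)) j"
      using Cons by (auto simp: weighted_sum_def intro!: sum_mono divide_right_mono)
    also have "\<dots> = ?c ^ length ks * weighted_sum k (\<lambda>m. real m - 1) j"
      by (simp add: weighted_sum_def sum_distrib_left)
    also have "\<dots> \<le> ?c ^ length ks * (?c * (real j - 1))"
      using Cons.prems c by (intro mult_left_mono weighted_sum_pred_le) auto
    finally show ?case by (simp add: mult_ac)
  qed simp
  then show ?thesis by (simp add: nested_sum_diff)
qed

text \<open>The tile containing $x$ belongs to the least $a \ge 1$ whose left end is below $x$: by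
  minimality, $x$ does not exceed the left end of tile $a - 1$, which is the right end of
  tile $a$.\<close>

lemma exists_subinterval:
  assumes "n \<ge> 1" and "lower n ks < x" and "x \<le> upper n ks"
  shows "\<exists>a\<ge>1. lower n (ks @ [a]) < x \<and> x \<le> upper n (ks @ [a])"
proof -
  let ?P = "\<lambda>a. lower n (ks @ [Suc a]) < x"
  have "(\<lambda>a. lower n (ks @ [Suc a])) \<longlonglongrightarrow> lower n ks"
    using LIMSEQ_Suc[OF lower_snoc_tendsto[OF assms(1)]] .
  then have "eventually ?P sequentially"
    using assms(2) by (rule order_tendstoD)
  then obtain b where "?P b" by (auto simp: eventually_sequentially)
  define a where "a = (LEAST a. ?P a)"
  have "?P a" unfolding a_def by (rule LeastI) fact
  moreover have "x \<le> upper n (ks @ [Suc a])"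
  proof (cases a)
    case 0
    then show ?thesis using assms(3) by (simp add: upper_snoc_1)
  next
    case (Suc b)
    then have "\<not> ?P b" using not_less_Least[of b ?P] by (simp add: a_def)
    then show ?thesis using Suc by (simp add: upper_snoc_Suc[where k = "Suc b"])
  qed
  ultimately show ?thesis by (intro exI[of _ "Suc a"]) simp
qed


section \<open>Nested intervals along a sequence\<close>

abbreviation prefix_of :: "(nat \<Rightarrow> nat) \<Rightarrow> nat \<Rightarrow> nat list" where
  "prefix_of k r \<equiv> map k [0..<r]"

lemma incseq_lower: "n \<ge> 2 \<Longrightarrow> incseq (\<lambda>r. lower n (prefix_of k r))"
  using lower_snoc_gt by (auto intro!: incseq_SucI less_imp_le)

lemma decseq_upper: "n \<ge> 1 \<Longrightarrow> k \<in> T_hat \<Longrightarrow> decseq (\<lambda>r. upper n (prefix_of k r))"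
  using upper_snoc_le by (auto intro!: decseq_SucI simp: T_hat_def)

lemma lower_prefix_le_upper_prefix:
  assumes "n \<ge> 2" and "k \<in> T_hat"
  shows "lower n (prefix_of k s) \<le> upper n (prefix_of k r)"
proof -
  have "lower n (prefix_of k s) \<le> lower n (prefix_of k (max r s))"
    using incseq_lower[OF assms(1)] by (rule incseqD) simp
  also have "\<dots> \<le> upper n (prefix_of k (max r s))"
    using assms(1) by (intro lower_le_upper) simp
  also have "\<dots> \<le> upper n (prefix_of k r)"
    using assms by (intro decseqD[OF decseq_upper]) auto
  finally show ?thesis .
qed

lemma convergent_lower:
  assumes "n \<ge> 2" and "k \<in> T_hat"
  shows "convergent (\<lambda>r. lower n (prefix_of k r))"
  using incseq_convergent[OF incseq_lower[OF assms(1)], of k]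
    lower_prefix_le_upper_prefix[OF assms, of _ 0]
  by (metis convergentI)

lemma lower_tendsto_h_lim:
  assumes "n \<ge> 2" and "k \<in> T_hat"
  shows "(\<lambda>r. lower n (prefix_of k r)) \<longlonglongrightarrow> h_lim n k"
  using convergent_lower[OF assms] by (simp add: h_lim_def H_star_eq_nested_sum convergent_LIMSEQ_iff)

lemma lower_less_h_lim:
  assumes "n \<ge> 2" and "k \<in> T_hat"
  shows "lower n (prefix_of k r) < h_lim n k"
proof -
  have "lower n (prefix_of k r) < lower n (prefix_of k (Suc r))"
    using lower_snoc_gt[OF assms(1)] by simp
  also have "\<dots> \<le> h_lim n k"
    using assms by (intro incseq_le[OF incseq_lower lower_tendsto_h_lim])
  finally show ?thesis .
qed

lemma h_lim_le_upper:
  assumes "n \<ge> 2" and "k \<in> T_hat"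
  shows "h_lim n k \<le> upper n (prefix_of k r)"
  using lower_tendsto_h_lim[OF assms] lower_prefix_le_upper_prefix[OF assms]
  by (intro LIMSEQ_le_const2) auto

text \<open>Both \<open>x\<close> and the limit lie in every interval along \<open>k\<close>, and the lengths tend to 0.\<close>

lemma h_lim_eqI:
  assumes "n \<ge> 2" and "k \<in> T_hat"
    and bounds: "\<And>r. lower n (prefix_of k r) < x \<and> x \<le> upper n (prefix_of k r)"
  shows "h_lim n k = x"
proof -
  let ?c = "1 - 1 / real n"
  have "(\<lambda>r. ?c ^ r * (real n - 1)) \<longlonglongrightarrow> 0 * (real n - 1)"
    using assms(1) by (intro tendsto_mult LIMSEQ_power_zero tendsto_const) simp
  then have lim: "(\<lambda>r. ?c ^ r * (real n - 1)) \<longlonglongrightarrow> 0" by simp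
  have close: "\<bar>h_lim n k - x\<bar> \<le> ?c ^ r * (real n - 1)" for r
  proof -
    have "upper n (prefix_of k r) - lower n (prefix_of k r) \<le> ?c ^ r * (real n - 1)"
      using upper_minus_lower_le[of n n "prefix_of k r"] assms(1,2) by (auto simp: T_hat_def)
    then show ?thesis
      using bounds[of r] lower_less_h_lim[OF assms(1,2), of r] h_lim_le_upper[OF assms(1,2), of r]
      by linarith
  qed
  have "\<bar>h_lim n k - x\<bar> \<le> 0"
    by (rule LIMSEQ_le_const[OF lim]) (use close in auto)
  then show ?thesis by simp
qed


section \<open>Bijectivity\<close>

text \<open>The map is strictly decreasing for the lexicographic order: after the common prefix, the
  interval of the larger entry lies to the left of that of the smaller one.  The two intervals
  may share an endpoint, but values never reach the left end of their interval.\<close>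

lemma h_lim_less:
  assumes "n \<ge> 2" and "k \<in> T_hat" and "l \<in> T_hat"
    and "\<And>i. i < r \<Longrightarrow> k i = l i" and "k r < l r"
  shows "h_lim n l < h_lim n k"
proof -
  have eq: "prefix_of l (Suc r) = prefix_of k r @ [l r]" using assms(4) by simp
  have "h_lim n l \<le> upper n (prefix_of l (Suc r))"
    by (rule h_lim_le_upper) fact+
  also have "\<dots> \<le> lower n (prefix_of k r @ [k r])"
    unfolding eq using assms(1,5) by (intro upper_snoc_le_lower_snoc) simp_all
  also have "\<dots> = lower n (prefix_of k (Suc r))" by simp
  also have "\<dots> < h_lim n k"
    by (rule lower_less_h_lim) fact+
  finally show ?thesis .
qed

lemma inj_on_h_lim:
  assumes "n \<ge> 2" shows "inj_on (h_lim n) T_hat"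
proof (rule inj_onI, rule ccontr)
  fix k l assume kl: "k \<in> T_hat" "l \<in> T_hat" "h_lim n k = h_lim n l" "k \<noteq> l"
  define r where "r = (LEAST i. k i \<noteq> l i)"
  have "\<exists>i. k i \<noteq> l i" using kl(4) by auto
  then have "k r \<noteq> l r" unfolding r_def by (rule LeastI_ex)
  moreover have "k i = l i" if "i < r" for i
    using not_less_Least that unfolding r_def by blast
  ultimately show False
    using h_lim_less[OF assms kl(1,2), of r] h_lim_less[OF assms kl(2,1), of r] kl(3)
    by (metis less_irrefl linorder_neqE_nat)
qed

lemma exists_h_lim_eq:
  assumes "n \<ge> 2" and "1 < x" and "x \<le> real n"
  shows "\<exists>k\<in>T_hat. h_lim n k = x"
proof -
  let ?I = "\<lambda>ks. lower n ks < x \<and> x \<le> upper n ks"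
  have "\<forall>ks. \<exists>a. ?I ks \<longrightarrow> a \<ge> 1 \<and> ?I (ks @ [a])"
    using exists_subinterval[of n _ x] assms(1) by fastforce
  then obtain a where a: "\<And>ks. ?I ks \<Longrightarrow> a ks \<ge> 1 \<and> ?I (ks @ [a ks])" by metis
  define P where "P = rec_nat [] (\<lambda>_ ks. ks @ [a ks])"
  have P: "P 0 = []" "P (Suc r) = P r @ [a (P r)]" for r by (simp_all add: P_def)
  define k where "k r = a (P r)" for r
  have prefix: "prefix_of k r = P r" for r by (induction r) (simp_all add: P k_def)
  have I: "?I (P r)" for r
  proof (induction r)
    case (Suc r)
    then show ?case using a[of "P r"] by (simp add: P)
  qed (use assms in \<open>simp add: P\<close>)
  have k: "k \<in> T_hat" using a[OF I] by (simp add: T_hat_def k_def)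
  with I have "h_lim n k = x" by (intro h_lim_eqI assms(1)) (simp_all add: prefix)
  with k show ?thesis by blast
qed

theorem theorem1p1:
  fixes n :: nat
  assumes "n \<ge> 2"
  shows "(\<forall>k\<in>T_hat. convergent (\<lambda>r. H_star n (map k [0..<r]))) \<and>
         bij_betw (h_lim n) T_hat {1<..real n}"
proof -
  have "h_lim n k \<in> {1<..real n}" if "k \<in> T_hat" for k
    using lower_less_h_lim[OF assms that, of 0] h_lim_le_upper[OF assms that, of 0] by simp
  then have "h_lim n ` T_hat = {1<..real n}"
    using exists_h_lim_eq[OF assms] by fastforce
  with inj_on_h_lim[OF assms] convergent_lower[OF assms] show ?thesis
    by (simp add: bij_betw_def H_star_eq_nested_sum)
qed

end
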